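(* Let $(X,\|\cdot\|)$ be a real Banach space with dual space $X^{-1}$ and let $\mathcal{I}\subset(0,\infty)$ be a nonempty compact interval. Let $\{I_\lambda\}_{\lambda\in\mathcal{I}}$ be a family of $C^1$-functionals on $X$ of the form $I_\lambda(u)=A(u)-\lambda B(u)$, where $A,B:X\to\mathbb{R}$ are of class $C^1$ and even, $A(0)=0=B(0)$, $B$ is nonnegative on $X$, and either $A(u)\to+\infty$ or $B(u)\to+\infty$ as $\|u\|\to\infty$. If $\{I_\lambda\}_{\lambda\in\mathcal{I}}$ has a uniform symmetric mountain pass geometry, then: (i) for almost every $\lambda\in\mathcal{I}$, $I_\lambda$ admits a bounded Palais-Smale sequence $\{u^\lambda_{k,n}\}_{n}\subset X$ at each level $c_{k,\lambda}$ ($k\in\mathbb{N}$), that is, $$\sup_{n\in\mathbb{N}}\|u^\lambda_{k,n}\|<\infty,\qquad I_\lambda(u^\lambda_{k,n})\to c_{k,\lambda}\qquad\text{and}\qquad I'_\lambda(u^\lambda_{k,n})\to0\ \text{ in }X^{-1}\quad\text{as }n\to\infty;$$ (ii) for every $k\in\mathbb{N}$, the mapping $\lambda\mapsto c_{k,\lambda}$ is left continuous on $\mathcal{I}$.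
   Context: $\mathbb{N}=\{1,2,\dots\}$, $\mathbb{D}_k:=\{x\in\mathbb{R}^k : |x|\le1\}$, $\mathbb{S}^{k-1}:=\{x\in\mathbb{R}^k : |x|=1\}$. The family of even functionals $\{I_\lambda\}_{\lambda\in\mathcal{I}}$ is said to have a uniform symmetric mountain pass geometry if, for every $k\in\mathbb{N}$, there exists an odd continuous mapping $\gamma_{0k}:\mathbb{S}^{k-1}\to X\setminus\{0\}$ (independent of $\lambda$) such that $\max_{l\in\mathbb{S}^{k-1}}I_\lambda(\gamma_{0k}(l))<0$ uniformly in $\lambda\in\mathcal{I}$ (i.e. $\sup_{\lambda\in\mathcal{I}}\max_{l\in\mathbb{S}^{k-1}}I_\lambda(\gamma_{0k}(l))<0$), the class of mappings $$\Gamma_k:=\{\gamma\in C(\mathbb{D}_k,X) : \gamma\text{ is odd and }\gamma=\gamma_{0k}\text{ on }\mathbb{S}^{k-1}\}$$ is nonempty, and, for every $\lambda\in\mathcal{I}$, $$c_{k,\lambda}:=\inf_{\gamma\in\Gamma_k}\max_{l\in\mathbb{D}_k}I_\lambda(\gamma(l))>0.$$ The values $c_{k,\lambda}$ in the claim are those associated with such a fixed choice of mappings $\gamma_{0k}$. *)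

theory Defs
  imports "HOL-Analysis.Analysis"
begin

text \<open>
  Points of \<open>R^k\<close> are functions \<^typ>\<open>nat \<Rightarrow> real\<close> vanishing at all indices \<open>i \<ge> k\<close>, i.e. the
  carrier of the library topology \<^const>\<open>Euclidean_space\<close>. This allows the dimension \<open>k\<close> to be
  quantified inside a formula. The index \<open>k\<close> ranges over \<open>{1, 2, ...}\<close> throughout.
\<close>

definition unit_disc :: "nat \<Rightarrow> (nat \<Rightarrow> real) set" where
  "unit_disc k = {x \<in> topspace (Euclidean_space k). L2_set x {..<k} \<le> 1}"

text \<open>The sphere of dimension \<open>k - 1\<close>, the boundary of \<open>unit_disc k\<close>.\<close>

definition unit_sphere :: "nat \<Rightarrow> (nat \<Rightarrow> real) set" where
  "unit_sphere k = {x \<in> topspace (Euclidean_space k). L2_set x {..<k} = 1}"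

definition odd_on :: "(nat \<Rightarrow> real) set \<Rightarrow> ((nat \<Rightarrow> real) \<Rightarrow> 'a::real_normed_vector) \<Rightarrow> bool" where
  "odd_on S g \<longleftrightarrow> (\<forall>x\<in>S. g (\<lambda>i. - x i) = - g x)"

text \<open>The Frechet derivative as an element of the dual space (with the operator norm).\<close>

definition dual_deriv :: "('a::real_normed_vector \<Rightarrow> real) \<Rightarrow> 'a \<Rightarrow> ('a \<Rightarrow>\<^sub>L real)" where
  "dual_deriv f u = Blinfun (frechet_derivative f (at u))"

definition C1_functional :: "('a::real_normed_vector \<Rightarrow> real) \<Rightarrow> bool" where
  "C1_functional f \<longleftrightarrow>
     (\<forall>u. f differentiable (at u)) \<and> continuous_on UNIV (dual_deriv f)"

definition bounded_PS_sequence ::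
    "('a::real_normed_vector \<Rightarrow> real) \<Rightarrow> real \<Rightarrow> (nat \<Rightarrow> 'a) \<Rightarrow> bool" where
  "bounded_PS_sequence f c u \<longleftrightarrow>
     bounded (range u) \<and>
     (\<lambda>n. f (u n)) \<longlonglongrightarrow> c \<and>
     (\<lambda>n. dual_deriv f (u n)) \<longlonglongrightarrow> 0"

text \<open>
  The class of admissible maps with boundary values \<open>g0\<close>. Its members are total functions, but
  only their values on the disc matter.
\<close>

definition mp_class ::
    "nat \<Rightarrow> ((nat \<Rightarrow> real) \<Rightarrow> 'a::real_normed_vector) \<Rightarrow> ((nat \<Rightarrow> real) \<Rightarrow> 'a) set" where
  "mp_class k g0 =
     {g. continuous_map (subtopology (Euclidean_space k) (unit_disc k)) euclidean g \<and>
         odd_on (unit_disc k) g \<and> (\<forall>x\<in>unit_sphere k. g x = g0 x)}"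

text \<open>
  Maxima are written as suprema: a continuous functional along a continuous map attains its
  supremum on the compact disc or sphere. For continuous \<open>f\<close> and nonempty \<open>mp_class k g0\<close> the
  infimum below is a genuine one, since each supremum is at least that of \<open>f \<circ> g0\<close> on the sphere.
\<close>

definition mp_level ::
    "nat \<Rightarrow> ((nat \<Rightarrow> real) \<Rightarrow> 'a::real_normed_vector) \<Rightarrow> ('a \<Rightarrow> real) \<Rightarrow> real" where
  "mp_level k g0 f = (INF g\<in>mp_class k g0. SUP x\<in>unit_disc k. f (g x))"

text \<open>
  The family \<open>I\<close>, indexed by \<open>J\<close>, has a uniform symmetric mountain pass geometry with the
  chosen boundary maps \<open>g0 k\<close>; the geometry itself asks for the existence of such a \<open>g0\<close>, and the
  minimax levels are those of the chosen \<open>g0\<close>. The condition \<open>bdd_above\<close> only ensures that the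
  real supremum over \<open>J\<close> is not the unspecified supremum of an unbounded set.
\<close>

definition uniform_symmetric_mp_geometry ::
    "real set \<Rightarrow> (real \<Rightarrow> 'a::real_normed_vector \<Rightarrow> real) \<Rightarrow>
     (nat \<Rightarrow> (nat \<Rightarrow> real) \<Rightarrow> 'a) \<Rightarrow> bool" where
  "uniform_symmetric_mp_geometry J I g0 \<longleftrightarrow>
     (\<forall>k\<ge>1.
        continuous_map (subtopology (Euclidean_space k) (unit_sphere k)) euclidean (g0 k) \<and>
        odd_on (unit_sphere k) (g0 k) \<and>
        g0 k ` unit_sphere k \<subseteq> UNIV - {0} \<and>
        bdd_above ((\<lambda>l. SUP x\<in>unit_sphere k. I l (g0 k x)) ` J) \<and>
        (SUP l\<in>J. SUP x\<in>unit_sphere k. I l (g0 k x)) < 0 \<and>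
        mp_class k (g0 k) \<noteq> {} \<and>
        (\<forall>l\<in>J. mp_level k (g0 k) (I l) > 0))"

end

theory Submission
  imports Defs
begin

text \<open>
  Since \<open>B \<ge> 0\<close>, the level \<open>c l\<close> is nonincreasing in \<open>l\<close>; hence for almost every \<open>l\<close> the quotients
  \<open>(c (l - h) - c l) / h\<close> stay below some \<open>C\<close> along a sequence \<open>h \<rightarrow> 0\<close>. For such \<open>h\<close>, a map that is
  nearly optimal for \<open>l - h\<close> is nearly optimal for \<open>l\<close>, and at its points with value at least
  \<open>c l - h\<close> both \<open>B\<close> and \<open>A\<close> are bounded above independently of \<open>h\<close>, so by coercivity the
  high points of the map lie in a fixed ball.

  To find an almost critical point near these high points, Ekeland's principle replaces the
  usual deformation flow. It is applied to \<open>\<eta> \<mapsto> max (I l \<circ> \<eta>)\<close> on the complete metric space of odd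
  maps that agree with the given map \<open>\<gamma>\<close> wherever \<open>\<gamma>\<close> is low; the high points of such an \<open>\<eta>\<close>
  are close to high points of \<open>\<gamma>\<close>. If the derivative were large there, one step along an odd
  descent field, glued from finitely many directions on a compact set, would contradict the
  minimality of \<open>\<eta>\<close>.
\<close>

section \<open>Ekeland's variational principle\<close>

text \<open>Starting from \<open>x0\<close>, repeatedly pass to an almost minimiser of
  \<open>f\<close> among the points that are cheaper even after paying \<open>a\<close> times the
  distance. The values decrease and are bounded below, so the sequence is Cauchy, and nothing is
  cheaper than its limit. Lower semicontinuity is phrased through sublevel sets closed in the whole
  space, so that limits also stay in \<open>S\<close>.\<close>

lemma (in Metric_space) ekeland_variational_principle:
  fixes f :: "'a \<Rightarrow> real"
  assumes "mcomplete" "S \<subseteq> M" "x0 \<in> S" "a > 0"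
    and lsc: "\<And>b. closedin mtopology {x \<in> S. f x \<le> b}"
    and bdd: "\<And>x. x \<in> S \<Longrightarrow> m \<le> f x"
  obtains x where "x \<in> S" "f x + a * d x0 x \<le> f x0"
    "\<And>y. y \<in> S \<Longrightarrow> y \<noteq> x \<Longrightarrow> f x < f y + a * d x y"
proof -
  \<comment> \<open>\<open>P\<close> is Ekeland's partial order on \<open>S\<close>; the point
    sought is one whose only \<open>P\<close>-successor is itself.\<close>
  define P where "P x y \<longleftrightarrow> y \<in> S \<and> f y + a * d x y \<le> f x" for x y
  have P_trans: "P x z" if "P x y" "P y z" "x \<in> S" for x y z
  proof -
    have "d x z \<le> d x y + d y z"
      using that \<open>S \<subseteq> M\<close> unfolding P_def by (intro triangle) auto
    then have "a * d x z \<le> a * d x y + a * d y z"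
      using \<open>a > 0\<close> by (metis distrib_left mult_le_cancel_left_pos)
    then show ?thesis using that unfolding P_def by auto
  qed
  have step: "\<exists>y. P x y \<and> (\<forall>z. P x z \<longrightarrow> f y \<le> f z + (1/2)^n)" if "x \<in> S" for x n
  proof -
    have xx: "P x x" using that \<open>S \<subseteq> M\<close> unfolding P_def by auto
    have bb: "bdd_below (f ` {z. P x z})"
      using bdd unfolding P_def by (intro bdd_belowI[of _ m]) auto
    have "\<exists>v \<in> f ` {z. P x z}. v < Inf (f ` {z. P x z}) + (1/2)^n"
      using xx by (intro cInf_lessD) auto
    then obtain y where y: "P x y" "f y < Inf (f ` {z. P x z}) + (1/2)^n" by auto
    have "f y \<le> f z + (1/2)^n" if "P x z" for z
      using cINF_lower[OF bb, of z] that y(2) by auto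
    then show ?thesis using y by blast
  qed
  then obtain nxt where nxt: "\<And>x n. x \<in> S \<Longrightarrow> P x (nxt x n)"
    "\<And>x n z. x \<in> S \<Longrightarrow> P x z \<Longrightarrow> f (nxt x n) \<le> f z + (1/2)^n" by metis
  define \<sigma> where "\<sigma> = rec_nat x0 (\<lambda>n x. nxt x n)"
  have \<sigma>0: "\<sigma> 0 = x0" and \<sigma>Suc: "\<sigma> (Suc n) = nxt (\<sigma> n) n" for n
    by (simp_all add: \<sigma>_def)
  have \<sigma>S: "\<sigma> n \<in> S" for n
    by (induction n) (use nxt(1) \<open>x0 \<in> S\<close> in \<open>auto simp: \<sigma>0 \<sigma>Suc P_def\<close>)
  have \<sigma>P: "P (\<sigma> n) (\<sigma> (Suc n))" for n
    using nxt(1)[OF \<sigma>S] by (simp add: \<sigma>Suc)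
  have \<sigma>min: "f (\<sigma> (Suc n)) \<le> f z + (1/2)^n" if "P (\<sigma> n) z" for n z
    using nxt(2)[OF \<sigma>S that] by (simp add: \<sigma>Suc)
  have \<sigma>mono: "P (\<sigma> i) (\<sigma> j)" if "i \<le> j" for i j
    using that
  proof (induction rule: dec_induct)
    case base
    show ?case using \<sigma>S[of i] subsetD[OF \<open>S \<subseteq> M\<close> \<sigma>S[of i]] unfolding P_def by simp
  next
    case (step n)
    then show ?case using P_trans[OF _ \<sigma>P \<sigma>S] by simp
  qed
  have dec: "decseq (\<lambda>n. f (\<sigma> n))"
  proof (rule decseq_SucI)
    fix n
    have "0 \<le> a * d (\<sigma> n) (\<sigma> (Suc n))" using \<open>a > 0\<close> by simp
    then show "f (\<sigma> (Suc n)) \<le> f (\<sigma> n)" using \<sigma>P[of n] unfolding P_def by linarith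
  qed
  have "convergent (\<lambda>n. f (\<sigma> n))"
    using decseq_convergent[OF dec, of m] bdd \<sigma>S unfolding convergent_def by metis
  then have fC: "Cauchy (\<lambda>n. f (\<sigma> n))" by (rule convergent_Cauchy)
  have "MCauchy \<sigma>"
    unfolding MCauchy_def
  proof (intro conjI allI impI)
    show "range \<sigma> \<subseteq> M" using \<sigma>S \<open>S \<subseteq> M\<close> by auto
    fix \<epsilon> :: real assume "\<epsilon> > 0"
    then have "a * \<epsilon> > 0" using \<open>a > 0\<close> by simp
    from CauchyD[OF fC this] obtain N where
      N: "\<And>i j. i \<ge> N \<Longrightarrow> j \<ge> N \<Longrightarrow> \<bar>f (\<sigma> i) - f (\<sigma> j)\<bar> < a * \<epsilon>" by auto
    have *: "d (\<sigma> i) (\<sigma> j) < \<epsilon>" if "N \<le> i" "i \<le> j" for i j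
    proof -
      have "a * d (\<sigma> i) (\<sigma> j) < a * \<epsilon>"
        using \<sigma>mono[OF that(2)] N[of i j] that unfolding P_def by linarith
      then show ?thesis using \<open>a > 0\<close> by simp
    qed
    show "\<exists>N. \<forall>i j. N \<le> i \<longrightarrow> N \<le> j \<longrightarrow> d (\<sigma> i) (\<sigma> j) < \<epsilon>"
      using * commute by (metis nle_le)
  qed
  then obtain x where x: "limitin mtopology \<sigma> x sequentially"
    using \<open>mcomplete\<close> unfolding mcomplete_def by blast
  have dlim: "(\<lambda>n. d (\<sigma> n) y) \<longlonglongrightarrow> d x y" if "y \<in> M" for y
  proof (rule LIM_zero_cancel, rule Lim_null_comparison)
    show "(\<lambda>n. d (\<sigma> n) x) \<longlonglongrightarrow> 0"
      using x unfolding limitin_metric_dist_null by blast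
    have xM: "x \<in> M" by (rule limitin_mspace[OF x])
    have "\<bar>d (\<sigma> n) y - d x y\<bar> \<le> d (\<sigma> n) x" for n
      using triangle[OF subsetD[OF \<open>S \<subseteq> M\<close> \<sigma>S] xM that, of n]
        triangle[OF xM subsetD[OF \<open>S \<subseteq> M\<close> \<sigma>S] that, of n] commute[of x "\<sigma> n"] by linarith
    then show "\<forall>\<^sub>F n in sequentially. norm (d (\<sigma> n) y - d x y) \<le> d (\<sigma> n) x"
      by simp
  qed
  have xP: "P (\<sigma> n) x" for n
  proof -
    \<comment> \<open>From \<open>n\<close> on the sequence eventually lies in this closed sublevel
      set; the slack \<open>e\<close> absorbs that \<open>d (\<sigma> j) (\<sigma> n)\<close> only
      converges to \<open>d x (\<sigma> n)\<close>.\<close>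
    have le: "x \<in> S \<and> f x \<le> f (\<sigma> n) - a * d (\<sigma> n) x + e" if "e > 0" for e
    proof -
      have "(\<lambda>j. f (\<sigma> n) - a * d (\<sigma> j) (\<sigma> n)) \<longlonglongrightarrow> f (\<sigma> n) - a * d x (\<sigma> n)"
        by (intro tendsto_diff tendsto_mult tendsto_const dlim subsetD[OF \<open>S \<subseteq> M\<close> \<sigma>S])
      then have "\<forall>\<^sub>F j in sequentially. f (\<sigma> n) - a * d (\<sigma> j) (\<sigma> n) < f (\<sigma> n) - a * d x (\<sigma> n) + e"
        by (rule order_tendstoD) (use that in auto)
      then have "\<forall>\<^sub>F j in sequentially. \<sigma> j \<in> {y \<in> S. f y \<le> f (\<sigma> n) - a * d (\<sigma> n) x + e}"
        using eventually_ge_at_top[of n]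
      proof eventually_elim
        case (elim j)
        then show ?case using \<sigma>mono[of n j] \<sigma>S unfolding P_def by (auto simp: commute)
      qed
      from limitin_closedin[OF x lsc this] show ?thesis by auto
    qed
    have "f x \<le> f (\<sigma> n) - a * d (\<sigma> n) x"
      by (rule field_le_epsilon) (use le in blast)
    then show ?thesis using le[of 1] unfolding P_def by auto
  qed
  show thesis
  proof
    show "x \<in> S" using xP unfolding P_def by auto
    show "f x + a * d x0 x \<le> f x0" using xP[of 0] \<sigma>0 unfolding P_def by auto
    fix y assume y: "y \<in> S" "y \<noteq> x"
    show "f x < f y + a * d x y"
    proof (rule ccontr)
      assume "\<not> ?thesis"
      then have "P x y" using y unfolding P_def by auto
      \<comment> \<open>A successor of the limit succeeds every \<open>\<sigma> n\<close>, so almost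
        minimality at stage \<open>n\<close> forces \<open>y\<close> to within
        \<open>(1/2)^n / a\<close> of \<open>\<sigma> (Suc n)\<close>; hence \<open>y\<close> is the
        limit itself.\<close>
      then have yP: "P (\<sigma> n) y" for n using P_trans xP \<sigma>S by blast
      have "norm (d (\<sigma> (Suc n)) y) \<le> (1/2)^n / a" for n
      proof -
        have "a * d (\<sigma> (Suc n)) y \<le> (1/2)^n"
          using \<sigma>min[OF yP[of n]] yP[of "Suc n"] unfolding P_def by linarith
        then show ?thesis using \<open>a > 0\<close> by (simp add: field_simps)
      qed
      then have "\<forall>\<^sub>F n in sequentially. norm (d (\<sigma> (Suc n)) y) \<le> (1/2)^n / a"
        by (rule always_eventually[OF allI])
      moreover have "(\<lambda>n. (1/2)^n / a) \<longlonglongrightarrow> 0"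
        by (rule tendsto_divide_zero, rule LIMSEQ_power_zero) simp
      ultimately have "(\<lambda>n. d (\<sigma> (Suc n)) y) \<longlonglongrightarrow> 0"
        by (rule Lim_null_comparison)
      moreover have "(\<lambda>n. d (\<sigma> (Suc n)) y) \<longlonglongrightarrow> d x y"
        by (rule LIMSEQ_Suc[OF dlim[OF subsetD[OF \<open>S \<subseteq> M\<close> y(1)]]])
      ultimately have "d x y = 0" by (metis LIMSEQ_unique)
      then show False using y zero[OF limitin_mspace[OF x] subsetD[OF \<open>S \<subseteq> M\<close> y(1)]] by simp
    qed
  qed
qed

section \<open>Descent fields on compact sets\<close>

text \<open>The operator norm need not be attained, but every \<open>b\<close> strictly below it is
  beaten by some quotient \<open>\<bar>g x\<bar> / norm x\<close>; normalising \<open>x\<close> and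
  choosing its sign gives \<open>w\<close>.\<close>

lemma blinfun_descent_direction:
  fixes g :: "'a::real_normed_vector \<Rightarrow>\<^sub>L real"
  assumes "b < norm g" "b \<ge> 0"
  obtains w where "norm w \<le> 1" "g w < - b"
proof -
  have "\<exists>x. \<not> norm (g x) \<le> b * norm x"
    using norm_blinfun_bound[OF \<open>b \<ge> 0\<close>, of g] assms by fastforce
  then obtain x where x: "b * norm x < \<bar>g x\<bar>" by (auto simp: not_le)
  have nx: "norm x > 0" using x by (cases "x = 0") auto
  define w where "w = (- sgn (g x) / norm x) *\<^sub>R x"
  have "g w = - (sgn (g x) * g x) / norm x"
    by (simp add: w_def blinfun.scaleR_right blinfun.minus_right)
  also have "sgn (g x) * g x = \<bar>g x\<bar>" by (simp add: abs_sgn mult.commute)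
  finally have "g w = - (\<bar>g x\<bar> / norm x)" by simp
  moreover have "b < \<bar>g x\<bar> / norm x" using x nx by (simp add: field_simps)
  ultimately have "g w < - b" by simp
  moreover have "norm w \<le> 1" using nx by (auto simp: w_def abs_sgn_eq)
  ultimately show thesis using that by blast
qed

text \<open>A descent direction at one point still works nearby because \<open>g\<close> is
  continuous. Compactness leaves finitely many directions, and convex combinations preserve both the
  norm bound and the descent bound.\<close>

lemma pseudo_gradient_on_compact:
  fixes g :: "'a::real_normed_vector \<Rightarrow> 'a \<Rightarrow>\<^sub>L real"
  assumes "compact Q" and cont: "continuous_on UNIV g" and "b \<ge> 0"
    and large: "\<And>u. u \<in> Q \<Longrightarrow> b < norm (g u)"
  obtains V where "continuous_on Q V" "\<And>u. u \<in> Q \<Longrightarrow> norm (V u) \<le> 1"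
    "\<And>u. u \<in> Q \<Longrightarrow> g u (V u) < - b"
proof -
  have "\<exists>w. norm w \<le> 1 \<and> g u w < - b" if "u \<in> Q" for u
    using blinfun_descent_direction[OF large[OF that] \<open>b \<ge> 0\<close>] by metis
  then obtain w where w: "\<And>u. u \<in> Q \<Longrightarrow> norm (w u) \<le> 1 \<and> g u (w u) < - b" by metis
  have "open {y. g y (w u) < - b}" for u
    by (intro open_Collect_less continuous_intros cont)
  moreover have "Q \<subseteq> (\<Union>u\<in>Q. {y. g y (w u) < - b})" using w by fast
  ultimately obtain C where C: "C \<subseteq> Q" "finite C" "Q \<subseteq> (\<Union>u\<in>C. {y. g y (w u) < - b})"
    by (rule compactE_image[OF \<open>compact Q\<close>]) simp
  \<comment> \<open>The weights of the partition of unity are the amounts by which each direction succeeds.\<close>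
  define \<phi> where "\<phi> u y = max 0 (- b - g y (w u))" for u y
  define \<Phi> where "\<Phi> y = (\<Sum>u\<in>C. \<phi> u y)" for y
  have \<phi>nn: "\<phi> u y \<ge> 0" for u y by (simp add: \<phi>_def)
  have \<Phi>pos: "\<Phi> y > 0" if y: "y \<in> Q" for y
  proof -
    obtain u where "u \<in> C" "g y (w u) < - b" using C y by auto
    then show ?thesis unfolding \<Phi>_def using C(2) \<phi>nn by (intro sum_pos2[of _ u]) (auto simp: \<phi>_def)
  qed
  define V where "V y = (1 / \<Phi> y) *\<^sub>R (\<Sum>u\<in>C. \<phi> u y *\<^sub>R w u)" for y
  show thesis
  proof
    have \<phi>c: "continuous_on Q (\<phi> u)" for u
      unfolding \<phi>_def by (intro continuous_intros continuous_on_subset[OF cont]) auto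
    show "continuous_on Q V"
      unfolding V_def \<Phi>_def
      by (intro continuous_intros \<phi>c) (use \<Phi>pos in \<open>force simp: \<Phi>_def\<close>)
    fix y assume y: "y \<in> Q"
    have "norm (\<Sum>u\<in>C. \<phi> u y *\<^sub>R w u) \<le> (\<Sum>u\<in>C. \<phi> u y)"
    proof (rule sum_norm_le)
      fix u assume "u \<in> C"
      then show "norm (\<phi> u y *\<^sub>R w u) \<le> \<phi> u y"
        using w[of u] C(1) \<phi>nn[of u y] by (auto intro: mult_left_le)
    qed
    then show "norm (V y) \<le> 1" using \<Phi>pos[OF y] by (simp add: V_def \<Phi>_def)
    obtain u0 where u0: "u0 \<in> C" "g y (w u0) < - b" using C y by auto
    \<comment> \<open>A direction that fails at \<open>y\<close> has weight zero there, so no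
      summand violates the bound; \<open>u0\<close> makes the inequality strict.\<close>
    have "(\<Sum>u\<in>C. \<phi> u y * g y (w u)) < (\<Sum>u\<in>C. \<phi> u y * (- b))"
    proof (rule sum_strict_mono_ex1[OF C(2)])
      show "\<forall>u\<in>C. \<phi> u y * g y (w u) \<le> \<phi> u y * (- b)"
      proof
        fix u
        show "\<phi> u y * g y (w u) \<le> \<phi> u y * (- b)"
        proof (cases "g y (w u) \<le> - b")
          case True
          then show ?thesis by (intro mult_left_mono \<phi>nn)
        qed (simp add: \<phi>_def)
      qed
      have "\<phi> u0 y * g y (w u0) < \<phi> u0 y * (- b)"
        using u0 by (intro mult_strict_left_mono) (auto simp: \<phi>_def)
      then show "\<exists>u\<in>C. \<phi> u y * g y (w u) < \<phi> u y * (- b)" using u0 by blast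
    qed
    also have "\<dots> = \<Phi> y * (- b)" unfolding \<Phi>_def by (rule sum_distrib_right[symmetric])
    finally show "g y (V y) < - b"
      using \<Phi>pos[OF y]
      by (simp add: V_def blinfun.scaleR_right blinfun.sum_right field_simps)
  qed
qed

text \<open>Since \<open>f\<close> is even, \<open>g\<close> is odd, so antisymmetrising a
  pseudo-gradient keeps its descent rate \<open>2 * b\<close>. Half of that rate is given up to
  obtain, by uniform continuity on a compact set, one step length \<open>t0\<close> valid at all
  points of \<open>Q\<close>.\<close>

lemma odd_descent_field:
  fixes f :: "'a::real_normed_vector \<Rightarrow> real" and g :: "'a \<Rightarrow> 'a \<Rightarrow>\<^sub>L real"
  assumes "compact Q" and sym: "\<And>u. u \<in> Q \<Longrightarrow> - u \<in> Q"
    and deriv: "\<And>u. (f has_derivative g u) (at u)" and cont: "continuous_on UNIV g"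
    and even: "\<And>u. f (- u) = f u"
    and "b > 0" and large: "\<And>u. u \<in> Q \<Longrightarrow> 2 * b < norm (g u)"
  obtains V t0 where "continuous_on Q V" "\<And>u. u \<in> Q \<Longrightarrow> norm (V u) \<le> 1"
    "\<And>u. u \<in> Q \<Longrightarrow> V (- u) = - V u" "t0 > 0"
    "\<And>u s. u \<in> Q \<Longrightarrow> 0 \<le> s \<Longrightarrow> s \<le> t0 \<Longrightarrow> f (u + s *\<^sub>R V u) \<le> f u - b * s"
proof -
  have g_odd: "g (- u) h = - g u h" for u h
  proof -
    have "((\<lambda>v. f (- v)) has_derivative (\<lambda>h. g (- u) (- h))) (at u)"
      by (rule has_derivative_compose[of uminus uminus u UNIV f "g (- u)", OF _ deriv])
        (auto intro!: derivative_eq_intros)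
    then have "(f has_derivative (\<lambda>h. g (- u) (- h))) (at u)" by (simp add: even)
    then have "(\<lambda>h. g (- u) (- h)) = g u" using has_derivative_unique deriv by blast
    then have "g (- u) (- h) = g u h" by metis
    then show ?thesis by (simp add: blinfun.minus_right)
  qed
  obtain W where Wc: "continuous_on Q W" and Wn: "\<And>u. u \<in> Q \<Longrightarrow> norm (W u) \<le> 1"
    and Wd: "\<And>u. u \<in> Q \<Longrightarrow> g u (W u) < - (2 * b)"
    using pseudo_gradient_on_compact[OF \<open>compact Q\<close> cont _ large] \<open>b > 0\<close> by auto
  define V where "V u = (1/2) *\<^sub>R (W u - W (- u))" for u
  have Vc: "continuous_on Q V"
    unfolding V_def using sym
    by (intro continuous_intros Wc continuous_on_compose2[OF Wc]) auto
  have Vn: "norm (V u) \<le> 1" if "u \<in> Q" for u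
    using norm_triangle_ineq4[of "W u" "W (- u)"] Wn[OF that] Wn[OF sym[OF that]]
    by (simp add: V_def)
  have Vd: "g u (V u) < - (2 * b)" if "u \<in> Q" for u
  proof -
    have "g u (V u) = (g u (W u) + g (- u) (W (- u))) / 2"
      by (simp add: V_def blinfun.scaleR_right blinfun.diff_right g_odd)
    then show ?thesis using Wd[OF that] Wd[OF sym[OF that]] by simp
  qed
  define G where "G = (\<lambda>(s, u). g (u + s *\<^sub>R V u) (V u))"
  have "continuous_on ({0..1::real} \<times> Q) G"
    unfolding G_def case_prod_unfold
    by (intro continuous_intros continuous_on_compose2[OF cont] continuous_on_compose2[OF Vc]) auto
  then have "uniformly_continuous_on ({0..1::real} \<times> Q) G"
    by (rule compact_uniformly_continuous) (intro compact_Times \<open>compact Q\<close> compact_Icc)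
  from uniformly_continuous_onE[OF this \<open>b > 0\<close>] obtain \<delta> where "\<delta> > 0" and
    \<delta>: "\<And>p q. p \<in> {0..1} \<times> Q \<Longrightarrow> q \<in> {0..1} \<times> Q \<Longrightarrow> dist q p < \<delta> \<Longrightarrow> dist (G q) (G p) < b"
    by metis
  \<comment> \<open>Halving \<open>\<delta>\<close> puts \<open>(s, u)\<close> strictly closer than
    \<open>\<delta>\<close> to \<open>(0, u)\<close>; the bound 1 keeps \<open>s\<close> in the
    domain on which \<open>G\<close> is uniformly continuous.\<close>
  define t0 where "t0 = min 1 (\<delta> / 2)"
  have t0: "t0 > 0" "t0 \<le> 1" "t0 < \<delta>" using \<open>\<delta> > 0\<close> by (auto simp: t0_def)
  have neg: "g (u + s *\<^sub>R V u) (V u) < - b" if "u \<in> Q" "0 \<le> s" "s \<le> t0" for u s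
  proof -
    have "dist (G (s, u)) (G (0, u)) < b"
      using that t0 by (intro \<delta>) (auto simp: dist_Pair_Pair)
    then show ?thesis using Vd[OF that(1)] by (auto simp: G_def dist_real_def)
  qed
  have "f (u + s *\<^sub>R V u) \<le> f u - b * s" if u: "u \<in> Q" and s: "0 \<le> s" "s \<le> t0" for u s
  proof (cases "s = 0")
    case False
    then have "0 < s" using s by simp
    have D: "((\<lambda>r. f (u + r *\<^sub>R V u)) has_derivative (\<lambda>h. h * g (u + r *\<^sub>R V u) (V u))) (at r)" for r
    proof -
      have "((\<lambda>r. f (u + r *\<^sub>R V u)) has_derivative (\<lambda>h. g (u + r *\<^sub>R V u) (h *\<^sub>R V u))) (at r)"
        by (rule has_derivative_compose[OF _ deriv]) (auto intro!: derivative_eq_intros)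
      then show ?thesis by (simp add: blinfun.scaleR_right)
    qed
    obtain r where r: "0 < r" "r < s"
      "f (u + s *\<^sub>R V u) - f (u + 0 *\<^sub>R V u) = (s - 0) * g (u + r *\<^sub>R V u) (V u)"
      using mvt_simple[OF \<open>0 < s\<close>, of "\<lambda>r. f (u + r *\<^sub>R V u)" "\<lambda>r h. h * g (u + r *\<^sub>R V u) (V u)"]
        has_derivative_at_withinI[OF D] by auto
    have "s * g (u + r *\<^sub>R V u) (V u) \<le> s * (- b)"
      using neg[OF u, of r] r s by (intro mult_left_mono) auto
    then show ?thesis using r(3) by (simp add: mult.commute)
  qed simp
  moreover have "V (- u) = - V u" for u by (simp add: V_def algebra_simps)
  ultimately show thesis using that Vc Vn t0 by blast
qed

section \<open>Almost critical points near a minimax path\<close>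

text \<open>Competitors that keep the low values of \<open>\<gamma>\<close> have maximum at least
  \<open>c\<close>, and \<open>\<gamma>\<close> exceeds \<open>c\<close> by at most
  \<open>\<delta>\<close>. Ekeland's principle with slope \<open>b\<close> therefore moves
  \<open>\<gamma>\<close> by at most \<open>\<delta> / b \<le> 1\<close>, whence the radius
  \<open>K + 1\<close>. If the derivative were large at all high points of the resulting map, a
  short step at descent rate \<open>b\<close> would lower the maximum by at least \<open>b\<close>
  times the distance moved, against Ekeland minimality.\<close>

lemma almost_critical_point_near_path:
  fixes f :: "'a::banach \<Rightarrow> real" and g :: "'a \<Rightarrow> 'a \<Rightarrow>\<^sub>L real"
    and D :: "'b::topological_space set"
  assumes deriv: "\<And>u. (f has_derivative g u) (at u)" and cont: "continuous_on UNIV g"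
    and even: "\<And>u. f (- u) = f u"
    and "compact D" "D \<noteq> {}" and \<sigma>: "\<And>x. x \<in> D \<Longrightarrow> \<sigma> x \<in> D"
    and \<gamma>: "continuous_on D \<gamma>" "\<And>x. x \<in> D \<Longrightarrow> \<gamma> (\<sigma> x) = - \<gamma> x"
    and minimax: "\<And>\<eta>. continuous_on D \<eta> \<Longrightarrow> (\<And>x. x \<in> D \<Longrightarrow> \<eta> (\<sigma> x) = - \<eta> x) \<Longrightarrow>
      (\<And>x. x \<in> D \<Longrightarrow> f (\<gamma> x) \<le> c - \<epsilon> \<Longrightarrow> \<eta> x = \<gamma> x) \<Longrightarrow> c \<le> (SUP x\<in>D. f (\<eta> x))"
    and upper: "\<And>x. x \<in> D \<Longrightarrow> f (\<gamma> x) \<le> c + \<delta>"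
    and bdd: "\<And>x. x \<in> D \<Longrightarrow> c - \<epsilon> \<le> f (\<gamma> x) \<Longrightarrow> norm (\<gamma> x) \<le> K"
    and "\<epsilon> > 0" "b > 0" "\<delta> \<le> b"
  shows "\<exists>u. norm u \<le> K + 1 \<and> c - \<epsilon> \<le> f u \<and> f u \<le> c + \<delta> \<and> norm (g u) \<le> 2 * b"
proof (rule ccontr)
  assume none: "\<not> ?thesis"
  have large: "2 * b < norm (g u)"
    if "norm u \<le> K + 1" "c - \<epsilon> \<le> f u" "f u \<le> c + \<delta>" for u
    using that none not_le by blast
  have f_cont: "continuous_on A f" for A
    using deriv by (meson differentiable_imp_continuous_on differentiable_on_def
        differentiableI differentiable_at_withinI)
  define X where "X = top_of_set D"
  \<comment> \<open>\<open>E\<close> carries the uniform distance and is complete because the target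
    is a Banach space. Its members are extensional, which is why maps are restricted to
    \<open>D\<close> below.\<close>
  define E :: "('b \<Rightarrow> 'a) metric" where "E = cfunspace X euclidean_metric"
  define \<Phi> where "\<Phi> \<eta> = (SUP x\<in>D. f (\<eta> x))" for \<eta>
  interpret E: Metric_space "mspace E" "mdist E" by (rule Metric_space_mspace_mdist)
  have topX: "topspace X = D" by (simp add: X_def)
  have E_mem: "\<eta> \<in> mspace E \<longleftrightarrow> \<eta> \<in> extensional D \<and> continuous_on D \<eta>" for \<eta>
    using compact_imp_bounded[OF compact_continuous_image[OF _ \<open>compact D\<close>]]
    by (auto simp: E_def topX) (simp_all add: X_def)
  have E_dist: "dist (\<eta> x) (\<zeta> x) \<le> mdist E \<eta> \<zeta>"
    if "\<eta> \<in> mspace E" "\<zeta> \<in> mspace E" "x \<in> D" for \<eta> \<zeta> x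
    using mdist_cfunspace_imp_mdist_le[of \<eta> X euclidean_metric \<zeta> "mdist E \<eta> \<zeta>" x] that
    by (simp add: E_def topX del: mspace_cfunspace)
  have E_complete: "E.mcomplete"
  proof -
    have "Met_TC.mcomplete TYPE('a)" by (simp add: complete_UNIV)
    from Met_TC.mcomplete_cfunspace[OF this, of X]
    have "mcomplete_of (cfunspace X (euclidean_metric :: 'a metric))"
      by (simp add: euclidean_metric_def Met_TC.Self_def)
    then show ?thesis by (simp add: E_def mcomplete_of_def)
  qed
  have \<Phi>_ub: "bdd_above ((\<lambda>x. f (\<eta> x)) ` D)" if "continuous_on D \<eta>" for \<eta>
  proof -
    have "continuous_on D (\<lambda>x. f (\<eta> x))"
      by (rule continuous_on_compose2[OF f_cont that subset_UNIV])
    then show ?thesis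
      using \<open>compact D\<close> by (metis bounded_imp_bdd_above compact_continuous_image compact_imp_bounded)
  qed
  have \<Phi>_le_iff: "\<Phi> \<eta> \<le> r \<longleftrightarrow> (\<forall>x\<in>D. f (\<eta> x) \<le> r)" if "continuous_on D \<eta>" for \<eta> r
    unfolding \<Phi>_def by (rule cSUP_le_iff[OF \<open>D \<noteq> {}\<close> \<Phi>_ub[OF that]])
  \<comment> \<open>Agreement with \<open>\<gamma>\<close> at its low points stands in for a
    boundary condition: in the application \<open>\<gamma>\<close> is low on the whole
    sphere.\<close>
  define S where "S = {\<eta> \<in> mspace E. (\<forall>x\<in>D. \<eta> (\<sigma> x) = - \<eta> x) \<and> (\<forall>x\<in>D. f (\<gamma> x) \<le> c - \<epsilon> \<longrightarrow> \<eta> x = \<gamma> x)}"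
  have S_c: "c \<le> \<Phi> \<eta>" if "\<eta> \<in> S" for \<eta>
    using that unfolding \<Phi>_def S_def E_mem by (intro minimax) auto
  have S_cont: "continuous_on D \<eta>" if "\<eta> \<in> S" for \<eta>
    using that unfolding S_def E_mem by simp
  \<comment> \<open>Uniform limits are pointwise limits, and each defining condition passes to
    pointwise limits.\<close>
  have S_closed: "closedin E.mtopology {\<eta> \<in> S. \<Phi> \<eta> \<le> r}" for r
    unfolding E.metric_closedin_iff_sequentially_closed
  proof (intro conjI allI impI)
    show "{\<eta> \<in> S. \<Phi> \<eta> \<le> r} \<subseteq> mspace E" by (auto simp: S_def)
    fix s \<eta> assume s: "range s \<subseteq> {\<eta> \<in> S. \<Phi> \<eta> \<le> r} \<and> limitin E.mtopology s \<eta> sequentially"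
    then have \<eta>: "\<eta> \<in> mspace E" and lim: "(\<lambda>n. mdist E (s n) \<eta>) \<longlonglongrightarrow> 0"
      by (auto simp: E.limitin_metric_dist_null)
    have sS: "s n \<in> S" "\<Phi> (s n) \<le> r" for n using s by auto
    have pw: "(\<lambda>n. s n x) \<longlonglongrightarrow> \<eta> x" if "x \<in> D" for x
    proof (rule tendsto_dist_iff[THEN iffD2], rule Lim_null_comparison[OF _ lim])
      show "\<forall>\<^sub>F n in sequentially. norm (dist (s n x) (\<eta> x)) \<le> mdist E (s n) \<eta>"
        using E_dist[OF _ \<eta> that] sS(1) by (auto simp: S_def)
    qed
    have "\<eta> (\<sigma> x) = - \<eta> x" if "x \<in> D" for x
    proof (rule LIMSEQ_unique[OF pw[OF \<sigma>[OF that]]])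
      show "(\<lambda>n. s n (\<sigma> x)) \<longlonglongrightarrow> - \<eta> x"
        using tendsto_minus[OF pw[OF that]] sS(1) that by (simp add: S_def)
    qed
    moreover have "\<eta> x = \<gamma> x" if "x \<in> D" "f (\<gamma> x) \<le> c - \<epsilon>" for x
      using LIMSEQ_unique[OF pw[OF that(1)], of "\<gamma> x"] sS(1) that by (simp add: S_def)
    moreover have "f (\<eta> x) \<le> r" if "x \<in> D" for x
    proof (rule LIMSEQ_le_const2)
      show "(\<lambda>n. f (s n x)) \<longlonglongrightarrow> f (\<eta> x)"
        using f_cont[of UNIV] pw[OF that] by (rule continuous_on_tendsto_compose) auto
      show "\<exists>N. \<forall>n\<ge>N. f (s n x) \<le> r"
        using sS that by (metis S_cont \<Phi>_le_iff)
    qed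
    ultimately show "\<eta> \<in> {\<eta> \<in> S. \<Phi> \<eta> \<le> r}"
      using \<eta> by (simp add: S_def \<Phi>_le_iff E_mem)
  qed
  define \<gamma>' where "\<gamma>' = restrict \<gamma> D"
  have \<gamma>'E: "\<gamma>' \<in> mspace E"
    using \<gamma>(1) by (auto simp: E_mem \<gamma>'_def cong: continuous_on_cong)
  have \<gamma>'S: "\<gamma>' \<in> S"
    using \<gamma>'E \<sigma> \<gamma>(2) by (simp add: S_def \<gamma>'_def)
  have \<Phi>\<gamma>': "\<Phi> \<gamma>' \<le> c + \<delta>"
    using upper unfolding \<Phi>_le_iff[OF S_cont[OF \<gamma>'S]] by (simp add: \<gamma>'_def)
  obtain \<eta> where \<eta>S: "\<eta> \<in> S" and \<eta>d: "\<Phi> \<eta> + b * mdist E \<gamma>' \<eta> \<le> \<Phi> \<gamma>'"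
    and \<eta>min: "\<And>\<zeta>. \<zeta> \<in> S \<Longrightarrow> \<zeta> \<noteq> \<eta> \<Longrightarrow> \<Phi> \<eta> < \<Phi> \<zeta> + b * mdist E \<eta> \<zeta>"
    using E.ekeland_variational_principle[OF E_complete _ \<gamma>'S \<open>b > 0\<close> S_closed S_c]
    by (metis (no_types, lifting) S_def mem_Collect_eq subsetI)
  note \<eta>c = S_cont[OF \<eta>S]
  have \<eta>_odd: "\<eta> (\<sigma> x) = - \<eta> x" if "x \<in> D" for x using \<eta>S that by (simp add: S_def)
  have \<eta>_le: "f (\<eta> x) \<le> \<Phi> \<eta>" if "x \<in> D" for x using \<Phi>_le_iff[OF \<eta>c] that by blast
  have \<eta>_close: "dist (\<gamma> x) (\<eta> x) \<le> 1" if "x \<in> D" for x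
  proof -
    have "b * mdist E \<gamma>' \<eta> \<le> b * 1" using \<eta>d S_c[OF \<eta>S] \<Phi>\<gamma>' \<open>\<delta> \<le> b\<close> by linarith
    then have "mdist E \<gamma>' \<eta> \<le> 1" using \<open>b > 0\<close> by (simp only: mult_le_cancel_left_pos)
    then show ?thesis using E_dist[OF \<gamma>'E _ that, of \<eta>] \<eta>S that by (simp add: S_def \<gamma>'_def)
  qed
  have \<eta>_top: "f (\<eta> x) \<le> c + \<delta>" if "x \<in> D" for x
  proof -
    have "0 \<le> b * mdist E \<gamma>' \<eta>" using \<open>b > 0\<close> by simp
    then show ?thesis using \<eta>_le[OF that] \<eta>d \<Phi>\<gamma>' by linarith
  qed
  define Q where "Q = {u \<in> \<eta> ` D. c - \<epsilon> \<le> f u}"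
  have "compact Q"
  proof -
    have "closed {u. c - \<epsilon> \<le> f u}"
      by (intro closed_Collect_le continuous_intros f_cont)
    then have "compact (\<eta> ` D \<inter> {u. c - \<epsilon> \<le> f u})"
      using compact_continuous_image[OF \<eta>c \<open>compact D\<close>] by (rule compact_Int_closed[rotated])
    then show ?thesis by (simp add: Q_def Collect_conj_eq)
  qed
  have Q_sym: "- u \<in> Q" if u: "u \<in> Q" for u
  proof -
    obtain x where "x \<in> D" "u = \<eta> x" using u by (auto simp: Q_def)
    then show ?thesis using u \<sigma>[of x] \<eta>_odd[of x] by (auto simp: Q_def even image_iff intro!: bexI[of _ "\<sigma> x"])
  qed
  have Q_large: "2 * b < norm (g u)" if "u \<in> Q" for u
  proof -
    obtain x where x: "x \<in> D" "u = \<eta> x" "c - \<epsilon> \<le> f (\<eta> x)" using \<open>u \<in> Q\<close> by (auto simp: Q_def)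
    \<comment> \<open>Were \<open>\<gamma>\<close> below this level at \<open>x\<close>, then
      \<open>\<eta> x = \<gamma> x\<close>, and \<open>\<eta>\<close> would be below it too. So the
      bound on the high points of \<open>\<gamma>\<close> applies.\<close>
    have "c - \<epsilon> \<le> f (\<gamma> x)"
      using x \<eta>S by (force simp: S_def)
    then have "norm (\<eta> x) \<le> K + 1"
      using bdd[OF x(1)] \<eta>_close[OF x(1)] norm_triangle_sub[of "\<eta> x" "\<gamma> x"]
      by (simp add: dist_norm norm_minus_commute)
    then show ?thesis using x \<eta>_top large by simp
  qed
  obtain V t0 where Vc: "continuous_on Q V" and Vn: "\<And>u. u \<in> Q \<Longrightarrow> norm (V u) \<le> 1"
    and V_odd: "\<And>u. u \<in> Q \<Longrightarrow> V (- u) = - V u" and "t0 > 0"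
    and V_desc: "\<And>u s. u \<in> Q \<Longrightarrow> 0 \<le> s \<Longrightarrow> s \<le> t0 \<Longrightarrow> f (u + s *\<^sub>R V u) \<le> f u - b * s"
    using odd_descent_field[OF \<open>compact Q\<close> Q_sym deriv cont even \<open>b > 0\<close> Q_large] by metis
  \<comment> \<open>The cutoff is 0 at level \<open>c - \<epsilon>\<close> and 1 from level
    \<open>c - \<epsilon> / 2\<close> upwards. Hence \<open>h\<close> extends continuously by zero
    and fixes low points; since \<open>\<theta>\<close> depends on \<open>u\<close> only through the
    even \<open>f\<close>, \<open>h\<close> stays odd.\<close>
  define \<theta> where "\<theta> u = min 1 (2 * (f u - (c - \<epsilon>)) / \<epsilon>)" for u
  define h where "h u = (if f u \<le> c - \<epsilon> then 0 else \<theta> u *\<^sub>R V u)" for u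
  have hc: "continuous_on (\<eta> ` D) h"
    unfolding h_def
  proof (rule continuous_on_cases_le)
    show "continuous_on {u \<in> \<eta> ` D. c - \<epsilon> \<le> f u} (\<lambda>u. \<theta> u *\<^sub>R V u)"
      unfolding Q_def[symmetric] \<theta>_def using \<open>\<epsilon> > 0\<close> by (intro continuous_intros Vc f_cont) auto
  qed (use f_cont in \<open>auto simp: \<theta>_def\<close>)
  have \<theta>01: "0 \<le> \<theta> u" "\<theta> u \<le> 1" if "c - \<epsilon> \<le> f u" for u
    using that \<open>\<epsilon> > 0\<close> by (auto simp: \<theta>_def)
  have hn: "norm (h u) \<le> 1" if "u \<in> \<eta> ` D" for u
  proof (cases "f u \<le> c - \<epsilon>")
    case False
    then show ?thesis using that \<theta>01[of u] Vn[of u] by (simp add: h_def Q_def mult_le_one)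
  qed (simp add: h_def)
  have h_odd: "h (- u) = - h u" if "u \<in> \<eta> ` D" for u
    using that V_odd[of u] by (auto simp: h_def even \<theta>_def Q_def)
  \<comment> \<open>With \<open>b * t \<le> \<epsilon> / 2\<close>, points below
    \<open>c - \<epsilon> / 2\<close>, where the cutoff may weaken the descent, already lie below
    \<open>c - b * t\<close>, hence below \<open>\<Phi> \<eta> - b * t\<close>.\<close>
  define t where "t = min t0 (\<epsilon> / (2 * b))"
  have t: "t > 0" "t \<le> t0" "b * t \<le> \<epsilon> / 2"
    using \<open>t0 > 0\<close> \<open>\<epsilon> > 0\<close> \<open>b > 0\<close> by (auto simp: t_def field_simps min_def)
  have desc: "f (u + t *\<^sub>R h u) \<le> \<Phi> \<eta> - b * t" if u: "u \<in> \<eta> ` D" for u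
  proof (cases "f u \<le> c - \<epsilon>")
    case True
    then show ?thesis using t S_c[OF \<eta>S] \<open>\<epsilon> > 0\<close> by (simp add: h_def)
  next
    case False
    then have uQ: "u \<in> Q" and c0: "0 \<le> \<theta> u" "\<theta> u \<le> 1" using u \<theta>01[of u] by (auto simp: Q_def)
    have "t * \<theta> u \<le> t0" using t c0 mult_left_le[of "\<theta> u" t] by linarith
    then have le: "f (u + t *\<^sub>R h u) \<le> f u - b * (t * \<theta> u)"
      using V_desc[OF uQ, of "t * \<theta> u"] False t c0 by (simp add: h_def)
    show ?thesis
    proof (cases "c - \<epsilon> / 2 \<le> f u")
      case True
      then have "\<theta> u = 1" using \<open>\<epsilon> > 0\<close> by (auto simp: \<theta>_def field_simps min_def)
      moreover have "f u \<le> \<Phi> \<eta>" using u \<eta>_le by auto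
      ultimately show ?thesis using le by simp
    next
      case False
      have "0 \<le> b * (t * \<theta> u)" using \<open>b > 0\<close> t c0 by simp
      then show ?thesis using le False t S_c[OF \<eta>S] by linarith
    qed
  qed
  define \<zeta> where "\<zeta> = restrict (\<lambda>x. \<eta> x + t *\<^sub>R h (\<eta> x)) D"
  have \<zeta>c: "continuous_on D \<zeta>"
  proof -
    have "continuous_on D (\<lambda>x. \<eta> x + t *\<^sub>R h (\<eta> x))"
      by (intro continuous_intros \<eta>c continuous_on_compose2[OF hc \<eta>c]) auto
    then show ?thesis by (simp add: \<zeta>_def cong: continuous_on_cong)
  qed
  have "\<zeta> x = \<gamma> x" if "x \<in> D" "f (\<gamma> x) \<le> c - \<epsilon>" for x
    using that \<eta>S by (simp add: S_def \<zeta>_def h_def)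
  then have \<zeta>S: "\<zeta> \<in> S"
    using \<zeta>c \<sigma> \<eta>_odd h_odd by (simp add: S_def E_mem) (simp add: \<zeta>_def)
  have "\<Phi> \<zeta> \<le> \<Phi> \<eta> - b * t"
    using desc by (simp add: \<Phi>_le_iff[OF \<zeta>c]) (simp add: \<zeta>_def)
  moreover have "mdist E \<eta> \<zeta> \<le> t"
    unfolding E_def
  proof (rule mdist_cfunspace_le)
    show "mdist euclidean_metric (\<eta> x) (\<zeta> x) \<le> t" if "x \<in> topspace X" for x
      using that hn[of "\<eta> x"] t by (simp add: topX \<zeta>_def dist_norm mult_left_le)
  qed (use t in simp)
  then have "b * mdist E \<eta> \<zeta> \<le> b * t" using \<open>b > 0\<close> by simp
  moreover have "0 < b * t" using \<open>b > 0\<close> t by simp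
  ultimately show False using \<eta>min[OF \<zeta>S] by fastforce
qed

section \<open>Left difference quotients of monotone functions\<close>

text \<open>A weak form of almost everywhere differentiability of monotone functions. On a bounded
  interval the integrals of the difference quotients are bounded uniformly in the step, so by
  Fatou's lemma their lower limit is finite almost everywhere.\<close>

lemma AE_frequently_bounded_left_quotient:
  fixes F :: "real \<Rightarrow> real"
  assumes "mono F"
  shows "AE x in lborel. \<exists>C. \<exists>\<^sub>F n in sequentially. (F x - F (x - 1 / Suc n)) * Suc n \<le> C"
proof -
  define h where "h n = 1 / real (Suc n)" for n
  have h: "h n > 0" "h n \<le> 1" for n by (simp_all add: h_def)
  define D where "D n x = (F x - F (x - h n)) * Suc n" for n x
  have D_nonneg: "D n x \<ge> 0" for n x
    using monoD[OF \<open>mono F\<close>, of "x - h n" x] h(1)[of n] by (simp add: D_def)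
  have [measurable]: "F \<in> borel_measurable borel"
    by (rule borel_measurable_mono[OF \<open>mono F\<close>])
  have [measurable]: "D n \<in> borel_measurable borel" for n
    unfolding D_def by measurable
  have F_int: "F integrable_on {p..q}" for p q
    using mono_on_subset[OF \<open>mono F\<close> subset_UNIV] by (rule integrable_on_mono_on)
  have "AE x in lborel. x \<in> {-real N..real N} \<longrightarrow> (\<exists>C. \<exists>\<^sub>F n in sequentially. D n x \<le> C)" for N
  proof -
    define a b where "a = - real N" and "b = real N"
    have "a \<le> b" by (simp add: a_def b_def)
    \<comment> \<open>The steps \<open>h n\<close> are at most 1, so \<open>a - 1\<close> lies to
      the left of every point at which \<open>F\<close> is evaluated.\<close>
    define K where "K = F b - F (a - 1)"
    define f where "f n x = ennreal (indicator {a..b} x * D n x)" for n x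
    have f_int: "(\<integral>\<^sup>+x. f n x \<partial>lborel) \<le> ennreal K" for n
    proof -
      let ?I = "\<lambda>p q. integral {p..q} F"
      have shift: "((\<lambda>x. F (x - h n)) has_integral ?I (a - h n) (b - h n)) {a..b}"
        using has_integral_shift_real_ivl[OF integrable_integral[OF F_int[of "a - h n" "b - h n"]], of "- h n"]
        by simp
      have DI: "(D n has_integral (?I a b - ?I (a - h n) (b - h n)) * Suc n) {a..b}"
        unfolding D_def
        by (intro has_integral_mult_left has_integral_diff shift integrable_integral F_int)
      have "((\<lambda>x. indicator {a..b} x * D n x) has_integral
          (?I a b - ?I (a - h n) (b - h n)) * Suc n) UNIV"
        using DI unfolding has_integral_restrict_UNIV[of "{a..b}" "D n", symmetric]
        by (rule has_integral_eq[rotated]) simp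
      then have eq: "(\<integral>\<^sup>+x. f n x \<partial>lborel) = ennreal ((?I a b - ?I (a - h n) (b - h n)) * Suc n)"
        unfolding f_def using D_nonneg
        by (intro nn_integral_has_integral_lborel) (auto simp: indicator_def)
      \<comment> \<open>In the difference of the two integrals everything cancels except the end
        strips \<open>{b - h n..b}\<close> and \<open>{a - h n..a}\<close>, each of width
        \<open>h n\<close>.\<close>
      have "?I (a - h n) a + ?I a b = ?I (a - h n) b"
        using h[of n] \<open>a \<le> b\<close> by (intro Henstock_Kurzweil_Integration.integral_combine[OF _ _ F_int]) auto
      moreover have "?I (a - h n) (b - h n) + ?I (b - h n) b = ?I (a - h n) b"
        using h[of n] \<open>a \<le> b\<close> by (intro Henstock_Kurzweil_Integration.integral_combine[OF _ _ F_int]) auto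
      moreover have "?I (b - h n) b \<le> h n * F b"
      proof -
        have "?I (b - h n) b \<le> integral {b - h n..b} (\<lambda>x. F b)"
          using \<open>mono F\<close> by (intro integral_le F_int integrable_on_const) (auto dest: monoD)
        then show ?thesis using h[of n] by simp
      qed
      moreover have "h n * F (a - 1) \<le> ?I (a - h n) a"
      proof -
        have "integral {a - h n..a} (\<lambda>x. F (a - 1)) \<le> ?I (a - h n) a"
          using h[of n] by (intro integral_le F_int integrable_on_const)
            (auto intro!: monoD[OF \<open>mono F\<close>])
        then show ?thesis using h[of n] by simp
      qed
      ultimately have "?I a b - ?I (a - h n) (b - h n) \<le> h n * K"
        by (simp add: K_def algebra_simps)
      then have "(?I a b - ?I (a - h n) (b - h n)) * Suc n \<le> h n * K * Suc n"
        by (intro mult_right_mono) auto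
      also have "\<dots> = K" by (simp add: h_def)
      finally show ?thesis unfolding eq by (rule ennreal_leI)
    qed
    have fm [measurable]: "f n \<in> borel_measurable lborel" for n
      unfolding f_def by measurable
    have "(\<integral>\<^sup>+x. liminf (\<lambda>n. f n x) \<partial>lborel) \<le> liminf (\<lambda>n. \<integral>\<^sup>+x. f n x \<partial>lborel)"
      by (rule nn_integral_liminf) (rule fm)
    also have "\<dots> \<le> liminf (\<lambda>n. ennreal K)"
      by (intro Liminf_mono always_eventually allI f_int)
    also have "\<dots> = ennreal K" by (simp add: Liminf_const)
    finally have "(\<integral>\<^sup>+x. liminf (\<lambda>n. f n x) \<partial>lborel) \<noteq> \<infinity>"
      by (metis ennreal_neq_top infinity_ennreal_def top.extremum_uniqueI)
    then have "AE x in lborel. liminf (\<lambda>n. f n x) \<noteq> \<infinity>"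
      by (intro nn_integral_PInf_AE) measurable
    then show ?thesis
    proof eventually_elim
      case (elim x)
      show ?case
      proof
        assume "x \<in> {- real N..real N}"
        then have fx: "f n x = ennreal (D n x)" for n by (simp add: f_def a_def b_def)
        obtain r where r: "liminf (\<lambda>n. f n x) = ennreal r" "r \<ge> 0"
          using elim by (cases "liminf (\<lambda>n. f n x)") auto
        have "\<exists>\<^sub>F n in sequentially. D n x \<le> r + 1"
        proof (rule ccontr)
          assume "\<not> ?thesis"
          then have "\<forall>\<^sub>F n in sequentially. ennreal (r + 1) \<le> f n x"
            unfolding not_frequently
            by eventually_elim (auto simp: fx intro!: ennreal_leI)
          then have "ennreal (r + 1) \<le> ennreal r"
            unfolding r(1)[symmetric] by (rule Liminf_bounded)
          then show False using r(2) by (simp add: ennreal_le_iff)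
        qed
        then show "\<exists>C. \<exists>\<^sub>F n in sequentially. D n x \<le> C" by blast
      qed
    qed
  qed
  then have "AE x in lborel. \<forall>N. x \<in> {-real N..real N} \<longrightarrow> (\<exists>C. \<exists>\<^sub>F n in sequentially. D n x \<le> C)"
    by (subst AE_all_countable) (rule allI)
  then show ?thesis
  proof eventually_elim
    case (elim x)
    obtain N where "\<bar>x\<bar> \<le> real N" using real_arch_simple by blast
    then have "x \<in> {- real N..real N}" by (simp add: abs_le_iff)
    then show ?case using elim[rule_format, of N] unfolding D_def h_def by blast
  qed
qed

section \<open>Minimax levels\<close>

lemma C1_functional_has_derivative:
  assumes "C1_functional f"
  shows "(f has_derivative dual_deriv f u) (at u)"
proof -
  have "(f has_derivative frechet_derivative f (at u)) (at u)"
    using assms by (simp add: C1_functional_def frechet_derivative_works)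
  then show ?thesis
    by (simp add: dual_deriv_def has_derivative_bounded_linear bounded_linear_Blinfun_apply)
qed

lemma C1_functional_continuous_on:
  assumes "C1_functional f"
  shows "continuous_on S f"
  using C1_functional_has_derivative[OF assms]
  by (meson continuous_at_imp_continuous_on has_derivative_continuous)

lemma C1_functionalI:
  assumes deriv: "\<And>u. (f has_derivative blinfun_apply (g u)) (at u)"
    and cont: "continuous_on UNIV g"
  shows "C1_functional f"
proof -
  have "dual_deriv f u = g u" for u
    using frechet_derivative_at[OF deriv[of u], symmetric] by (simp add: dual_deriv_def blinfun_apply_inverse)
  then show ?thesis
    using deriv cont by (auto simp: C1_functional_def differentiable_def cong: continuous_on_cong)
qed

lemma C1_functional_diff_scaled:
  assumes "C1_functional A" "C1_functional B"
  shows "C1_functional (\<lambda>u. A u - l * B u)"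
proof (rule C1_functionalI)
  show "((\<lambda>u. A u - l * B u) has_derivative
      blinfun_apply (dual_deriv A u - l *\<^sub>R dual_deriv B u)) (at u)" for u
    using C1_functional_has_derivative[OF assms(1), of u]
      C1_functional_has_derivative[OF assms(2), of u]
    by (auto intro!: derivative_eq_intros simp: blinfun.diff_left blinfun.scaleR_left)
  show "continuous_on UNIV (\<lambda>u. dual_deriv A u - l *\<^sub>R dual_deriv B u)"
    using assms by (intro continuous_intros) (auto simp: C1_functional_def)
qed

section \<open>Topology of the disc\<close>

lemma unit_disc_uminus: "x \<in> unit_disc k \<Longrightarrow> (\<lambda>i. - x i) \<in> unit_disc k"
  by (simp add: unit_disc_def topspace_Euclidean_space L2_set_def)

lemma zero_in_unit_disc: "(\<lambda>i. 0) \<in> unit_disc k"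
  by (simp add: unit_disc_def topspace_Euclidean_space L2_set_def)

lemma unit_sphere_subset_unit_disc: "unit_sphere k \<subseteq> unit_disc k"
  by (auto simp: unit_disc_def unit_sphere_def)

text \<open>\<open>Euclidean_space k\<close> is a subspace of the product topology on sequences,
  which is the topology of the type, and it contains the disc.\<close>

lemma continuous_map_unit_disc_iff:
  "continuous_map (subtopology (Euclidean_space k) (unit_disc k)) euclidean g \<longleftrightarrow>
   continuous_on (unit_disc k) g"
proof -
  have "subtopology (Euclidean_space k) (unit_disc k) = top_of_set (unit_disc k)"
    unfolding Euclidean_space_def subtopology_subtopology euclidean_product_topology[symmetric]
    by (rule arg_cong[where f = "subtopology (powertop_real UNIV)"])
      (auto simp: unit_disc_def topspace_Euclidean_space)
  then show ?thesis by simp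
qed

text \<open>The disc is a closed subset of a cube that is compact by Tychonoff's theorem.\<close>

lemma compact_unit_disc: "compact (unit_disc k)"
proof -
  have "compactin (product_topology (\<lambda>i. euclidean) UNIV) (PiE UNIV (\<lambda>i::nat. {-1..1::real}))"
    by (simp add: compactin_PiE)
  then have cube: "compact (PiE UNIV (\<lambda>i::nat. {-1..1::real}))"
    by (simp add: euclidean_product_topology)
  have "closed {x :: nat \<Rightarrow> real. L2_set x {..<k} \<le> 1}"
    unfolding L2_set_def
    by (intro closed_Collect_le continuous_intros continuous_on_product_coordinates)
  moreover have "closed (\<Inter>i\<in>{k..}. {x :: nat \<Rightarrow> real. x i = 0})"
    by (intro closed_INT ballI closed_Collect_eq continuous_intros continuous_on_product_coordinates)
  ultimately have "closed ((\<Inter>i\<in>{k..}. {x. x i = 0}) \<inter> {x :: nat \<Rightarrow> real. L2_set x {..<k} \<le> 1})"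
    by (intro closed_Int)
  also have "(\<Inter>i\<in>{k..}. {x. x i = 0}) \<inter> {x :: nat \<Rightarrow> real. L2_set x {..<k} \<le> 1} = unit_disc k"
    by (auto simp: unit_disc_def topspace_Euclidean_space)
  finally have "closed (unit_disc k)" .
  moreover have "unit_disc k \<subseteq> PiE UNIV (\<lambda>i. {-1..1})"
  proof
    fix x assume x: "x \<in> unit_disc k"
    have "\<bar>x i\<bar> \<le> 1" for i
    proof (cases "i < k")
      case True
      then have "\<bar>x i\<bar> \<le> L2_set (\<lambda>j. \<bar>x j\<bar>) {..<k}" by (intro member_le_L2_set) auto
      also have "\<dots> = L2_set x {..<k}" by (simp add: L2_set_def)
      finally show ?thesis using x by (simp add: unit_disc_def)
    qed (use x in \<open>simp add: unit_disc_def topspace_Euclidean_space\<close>)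
    then show "x \<in> PiE UNIV (\<lambda>i. {-1..1})" by (auto simp: abs_le_iff minus_le_iff)
  qed
  ultimately show ?thesis
    using cube by (metis compact_Int_closed inf.absorb_iff2)
qed

section \<open>Admissible maps and their levels\<close>

lemma mem_mp_class_iff:
  "g \<in> mp_class k g0 \<longleftrightarrow> continuous_on (unit_disc k) g \<and>
    (\<forall>x\<in>unit_disc k. g (\<lambda>i. - x i) = - g x) \<and> (\<forall>x\<in>unit_sphere k. g x = g0 x)"
  by (simp add: mp_class_def continuous_map_unit_disc_iff odd_on_def)

lemma bdd_above_along_mp_class:
  fixes f :: "'a::real_normed_vector \<Rightarrow> real"
  assumes "continuous_on UNIV f" "g \<in> mp_class k g0"
  shows "bdd_above ((\<lambda>x. f (g x)) ` unit_disc k)"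
proof -
  have "continuous_on (unit_disc k) (\<lambda>x. f (g x))"
    using assms(2) unfolding mem_mp_class_iff
    by (blast intro: continuous_on_compose2[OF assms(1) _ subset_UNIV])
  then show ?thesis
    by (metis bounded_imp_bdd_above compact_continuous_image compact_imp_bounded compact_unit_disc)
qed

text \<open>An odd map vanishes at the centre of the disc, so every supremum is at least
  \<open>f 0 = 0\<close>; this bounds the infimum from below.\<close>

lemma mp_level_le:
  fixes f :: "'a::real_normed_vector \<Rightarrow> real"
  assumes f: "continuous_on UNIV f" "f 0 = 0" and "g \<in> mp_class k g0"
  shows "mp_level k g0 f \<le> (SUP x\<in>unit_disc k. f (g x))"
  unfolding mp_level_def
proof (rule cINF_lower[OF bdd_belowI2])
  fix \<eta> assume \<eta>: "\<eta> \<in> mp_class k g0"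
  have "\<eta> (\<lambda>i. 0) = - \<eta> (\<lambda>i. 0)"
    using \<eta> zero_in_unit_disc[of k] unfolding mem_mp_class_iff by fastforce
  then have "2 *\<^sub>R \<eta> (\<lambda>i. 0) = 0" by (metis add.right_inverse scaleR_2)
  then have "\<eta> (\<lambda>i. 0) = 0" by simp
  then show "0 \<le> (SUP x\<in>unit_disc k. f (\<eta> x))"
    using cSUP_upper[OF zero_in_unit_disc bdd_above_along_mp_class[OF f(1) \<eta>]] f(2) by simp
qed fact

lemma mp_level_le_bound:
  fixes f :: "'a::real_normed_vector \<Rightarrow> real"
  assumes "continuous_on UNIV f" "f 0 = 0" "g \<in> mp_class k g0"
    and "\<And>x. x \<in> unit_disc k \<Longrightarrow> f (g x) \<le> r"
  shows "mp_level k g0 f \<le> r"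
proof -
  have "(SUP x\<in>unit_disc k. f (g x)) \<le> r"
    by (rule cSUP_least) (use zero_in_unit_disc assms(4) in blast)+
  then show ?thesis using mp_level_le[OF assms(1-3)] by linarith
qed

lemma mp_level_lessD:
  fixes f :: "'a::real_normed_vector \<Rightarrow> real"
  assumes f: "continuous_on UNIV f" and "mp_class k g0 \<noteq> {}" "mp_level k g0 f < r"
  obtains g where "g \<in> mp_class k g0" "\<And>x. x \<in> unit_disc k \<Longrightarrow> f (g x) < r"
proof -
  obtain g where g: "g \<in> mp_class k g0" "(SUP x\<in>unit_disc k. f (g x)) < r"
    using cInf_lessD[of "(\<lambda>g. SUP x\<in>unit_disc k. f (g x)) ` mp_class k g0" r] assms(2,3)
    unfolding mp_level_def by auto
  have "f (g x) < r" if "x \<in> unit_disc k" for x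
    using cSUP_upper[OF that bdd_above_along_mp_class[OF f g(1)]] g(2) by linarith
  then show thesis using that g(1) by blast
qed

lemma mp_level_mono:
  fixes f f' :: "'a::real_normed_vector \<Rightarrow> real"
  assumes f: "continuous_on UNIV f" "f 0 = 0" and f': "continuous_on UNIV f'"
    and ne: "mp_class k g0 \<noteq> {}" and le: "\<And>u. f u \<le> f' u"
  shows "mp_level k g0 f \<le> mp_level k g0 f'"
proof (rule dense_ge)
  fix r assume "mp_level k g0 f' < r"
  then obtain g where g: "g \<in> mp_class k g0" "\<And>x. x \<in> unit_disc k \<Longrightarrow> f' (g x) < r"
    using mp_level_lessD[OF f' ne] by metis
  show "mp_level k g0 f \<le> r"
  proof (rule mp_level_le_bound[OF f g(1)])
    show "f (g x) \<le> r" if "x \<in> unit_disc k" for x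
      using g(2)[OF that] le[of "g x"] by linarith
  qed
qed

text \<open>For \<open>m < l\<close> the level at \<open>m\<close> is no smaller, as
  \<open>B\<close> is nonnegative. Conversely, a map nearly optimal for \<open>l\<close> can be
  tested at \<open>m\<close>: \<open>B\<close> is bounded by some \<open>M\<close> along it, so the
  level rises by at most \<open>(l - m) * M\<close> above the near-optimal value.\<close>

lemma mp_level_left_continuous:
  fixes A B :: "'a::real_normed_vector \<Rightarrow> real"
  assumes cont: "continuous_on UNIV A" "continuous_on UNIV B"
    and zero: "A 0 = 0" "B 0 = 0" and B_nonneg: "\<And>u. B u \<ge> 0"
    and ne: "mp_class k g0 \<noteq> {}"
  shows "((\<lambda>m. mp_level k g0 (\<lambda>u. A u - m * B u)) \<longlongrightarrow>
    mp_level k g0 (\<lambda>u. A u - l * B u)) (at_left l)"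
proof (rule order_tendstoI)
  let ?c = "\<lambda>m. mp_level k g0 (\<lambda>u. A u - m * B u)"
  have I_cont: "continuous_on UNIV (\<lambda>u. A u - m * B u)" for m
    by (intro continuous_intros cont)
  have I_zero: "A 0 - m * B 0 = 0" for m by (simp add: zero)
  show "\<forall>\<^sub>F m in at_left l. r < ?c m" if "r < ?c l" for r
  proof -
    have "?c l \<le> ?c m" if "m < l" for m
      using that B_nonneg
      by (intro mp_level_mono I_cont I_zero ne diff_left_mono mult_right_mono) auto
    then show ?thesis
      using that less_le_trans unfolding eventually_at_filter
      by (intro always_eventually) blast
  qed
  show "\<forall>\<^sub>F m in at_left l. ?c m < r" if less: "?c l < r" for r
  proof -
    obtain s where s: "?c l < s" "s < r" using dense[OF less] by blast
    obtain g where g: "g \<in> mp_class k g0" "\<And>x. x \<in> unit_disc k \<Longrightarrow> A (g x) - l * B (g x) < s"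
      using mp_level_lessD[OF I_cont ne s(1)] by metis
    define M where "M = (SUP x\<in>unit_disc k. B (g x))"
    have M: "B (g x) \<le> M" if "x \<in> unit_disc k" for x
      unfolding M_def using cSUP_upper[OF that bdd_above_along_mp_class[OF cont(2) g(1)]] .
    have "((\<lambda>m. s + (l - m) * M) \<longlongrightarrow> s + (l - l) * M) (at_left l)"
      by (intro tendsto_intros)
    then have "\<forall>\<^sub>F m in at_left l. s + (l - m) * M < r"
      by (rule order_tendstoD) (use s in simp)
    moreover have "\<forall>\<^sub>F m in at_left l. m < l" by (simp add: eventually_at_filter)
    ultimately show ?thesis
    proof eventually_elim
      case (elim m)
      have "?c m \<le> s + (l - m) * M"
      proof (rule mp_level_le_bound[OF I_cont I_zero g(1)])
        fix x assume x: "x \<in> unit_disc k"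
        have "(l - m) * B (g x) \<le> (l - m) * M"
          using M[OF x] elim by (intro mult_left_mono) auto
        then show "A (g x) - m * B (g x) \<le> s + (l - m) * M"
          using g(2)[OF x] by (simp add: algebra_simps)
      qed
      then show ?case using elim by simp
    qed
  qed
qed

text \<open>The monotonicity trick of Struwe and Jeanjean: slow growth of the level to the left of
  \<open>l\<close> bounds \<open>B\<close>, and then \<open>A\<close>, at the high points of nearly
  optimal maps.\<close>

lemma bounded_PS_sequence_of_left_quotient:
  fixes A B :: "'a::banach \<Rightarrow> real"
  defines "I \<equiv> \<lambda>l u. A u - l * B u"
  assumes C1: "C1_functional A" "C1_functional B"
    and even: "\<And>u. A (- u) = A u" "\<And>u. B (- u) = B u"
    and zero: "A 0 = 0" "B 0 = 0" and B_nonneg: "\<And>u. B u \<ge> 0"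
    and coercive: "filterlim A at_top at_infinity \<or> filterlim B at_top at_infinity"
    and "l > 0" and ne: "mp_class k g0 \<noteq> {}"
    and boundary: "\<And>x. x \<in> unit_sphere k \<Longrightarrow> I l (g0 x) < 0"
    and level_pos: "mp_level k g0 (I l) > 0"
    and quotient: "\<exists>\<^sub>F n in sequentially.
      (mp_level k g0 (I (l - 1 / Suc n)) - mp_level k g0 (I l)) * Suc n \<le> C"
  shows "\<exists>u. bounded_PS_sequence (I l) (mp_level k g0 (I l)) u"
proof -
  define c where "c = mp_level k g0 (I l)"
  have I_C1: "C1_functional (I m)" for m
    unfolding I_def by (rule C1_functional_diff_scaled[OF C1])
  note I_cont = C1_functional_continuous_on[OF I_C1]
  have I_zero: "I m 0 = 0" for m by (simp add: I_def zero)
  have I_even: "I m (- u) = I m u" for m u by (simp add: I_def even)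
  define C' where "C' = max C 0"
  have C': "C \<le> C'" "0 \<le> C'" by (auto simp: C'_def)
  \<comment> \<open>These are the bounds on \<open>A\<close> and \<open>B\<close> derived below at
    high points, independent of the step \<open>h\<close>. When both hold, coercivity of either
    functional confines \<open>u\<close> to a ball.\<close>
  obtain K where K: "norm u \<le> K" if "A u \<le> c + (C' + 1) + l * (C' + 2)" "B u \<le> C' + 2" for u
  proof -
    define a where "a = max (c + (C' + 1) + l * (C' + 2)) (C' + 2) + 1"
    have "(\<forall>\<^sub>F u in at_infinity. a \<le> A u) \<or> (\<forall>\<^sub>F u in at_infinity. a \<le> B u)"
      using coercive by (auto simp: filterlim_at_top)
    then have "\<forall>\<^sub>F u in at_infinity. a \<le> A u \<or> a \<le> B u"
      by (auto elim: eventually_mono)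
    then obtain K where K: "\<And>u. K \<le> norm u \<Longrightarrow> a \<le> A u \<or> a \<le> B u"
      by (auto simp: eventually_at_infinity)
    show thesis
    proof (rule that[of K])
      fix u assume "A u \<le> c + (C' + 1) + l * (C' + 2)" "B u \<le> C' + 2"
      then have "\<not> (a \<le> A u \<or> a \<le> B u)" by (auto simp: a_def)
      then show "norm u \<le> K" using K[of u] by linarith
    qed
  qed
  have approx: "\<exists>u. norm u \<le> K + 1 \<and> \<bar>I l u - c\<bar> \<le> b \<and> norm (dual_deriv (I l) u) \<le> 2 * b"
    if "b > 0" for b
  proof -
    \<comment> \<open>For \<open>h < r\<close>, the bound \<open>c\<close> makes the negative
      boundary values lie below \<open>c - h\<close>, the bound 1 makes the estimate of
      \<open>A\<close> uniform, and the last one gives \<open>(C' + 1) * h \<le> b\<close>.\<close>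
    define r where "r = min (min l c) (min 1 (b / (C' + 1)))"
    have "r > 0" using \<open>l > 0\<close> level_pos \<open>b > 0\<close> C'(2) by (simp add: r_def c_def)
    have "(\<lambda>n. 1 / real (Suc n)) \<longlonglongrightarrow> 0"
      using LIMSEQ_inverse_real_of_nat by (simp add: inverse_eq_divide)
    then have "\<forall>\<^sub>F n in sequentially. 1 / real (Suc n) < r"
      using \<open>r > 0\<close> by (rule order_tendstoD)
    from frequently_eventually_conj[OF quotient this]
    obtain n where n: "(mp_level k g0 (I (l - 1 / Suc n)) - c) * Suc n \<le> C" "1 / real (Suc n) < r"
      unfolding c_def by (metis (no_types, lifting) frequently_ex)
    define h where "h = 1 / real (Suc n)"
    have h: "0 < h" "h \<le> l" "h \<le> c" "h \<le> 1" "h \<le> b / (C' + 1)"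
      using n(2) by (auto simp: h_def r_def)
    have hb: "(C' + 1) * h \<le> b" "h \<le> b"
    proof -
      show "(C' + 1) * h \<le> b" using h(5) C'(2) by (simp add: field_simps)
      have "0 \<le> C' * h" using h C' by simp
      then show "h \<le> b" using \<open>(C' + 1) * h \<le> b\<close> by (simp add: algebra_simps)
    qed
    have "mp_level k g0 (I (l - h)) - c \<le> C' * h"
      using n(1) C'(1) by (simp add: h_def field_simps)
    then have "mp_level k g0 (I (l - h)) < c + (C' + 1) * h"
      using h(1) by (simp add: algebra_simps)
    then obtain \<gamma> where \<gamma>: "\<gamma> \<in> mp_class k g0"
      and \<gamma>_le: "\<And>x. x \<in> unit_disc k \<Longrightarrow> I (l - h) (\<gamma> x) < c + (C' + 1) * h"
      using mp_level_lessD[OF I_cont ne] by metis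
    have I_split: "I (l - h) u = I l u + h * B u" for u by (simp add: I_def algebra_simps)
    \<comment> \<open>The path lemma is used with \<open>\<epsilon> = h\<close>,
      \<open>\<delta> = (C' + 1) * h\<close> and the antipodal map of the disc.\<close>
    have "\<exists>u. norm u \<le> K + 1 \<and> c - h \<le> I l u \<and> I l u \<le> c + (C' + 1) * h \<and>
      norm (dual_deriv (I l) u) \<le> 2 * b"
    proof (rule almost_critical_point_near_path[where D = "unit_disc k" and \<sigma> = "\<lambda>x i. - x i"])
      show "(I l has_derivative dual_deriv (I l) u) (at u)" for u
        by (rule C1_functional_has_derivative[OF I_C1])
      show "continuous_on UNIV (dual_deriv (I l))"
        using I_C1 by (simp add: C1_functional_def)
      show "compact (unit_disc k)" by (rule compact_unit_disc)
      show "unit_disc k \<noteq> {}" using zero_in_unit_disc by blast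
      show "continuous_on (unit_disc k) \<gamma>" using \<gamma> by (simp add: mem_mp_class_iff)
      show "\<gamma> (\<lambda>i. - x i) = - \<gamma> x" if "x \<in> unit_disc k" for x
        using \<gamma> that by (simp add: mem_mp_class_iff)
      show "c \<le> (SUP x\<in>unit_disc k. I l (\<eta> x))"
        if \<eta>: "continuous_on (unit_disc k) \<eta>" "\<And>x. x \<in> unit_disc k \<Longrightarrow> \<eta> (\<lambda>i. - x i) = - \<eta> x"
          "\<And>x. x \<in> unit_disc k \<Longrightarrow> I l (\<gamma> x) \<le> c - h \<Longrightarrow> \<eta> x = \<gamma> x" for \<eta>
        unfolding c_def
      proof (rule mp_level_le[OF I_cont I_zero])
        \<comment> \<open>On the sphere \<open>I l (g0 x) < 0 \<le> c - h\<close>, so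
          \<open>\<gamma>\<close> is low there and \<open>\<eta>\<close> inherits its boundary
          values.\<close>
        have "\<eta> x = g0 x" if x: "x \<in> unit_sphere k" for x
        proof -
          have "\<gamma> x = g0 x" using \<gamma> x by (simp add: mem_mp_class_iff)
          then show ?thesis
            using \<eta>(3)[of x] boundary[OF x] h(3) x unit_sphere_subset_unit_disc[of k] by auto
        qed
        then show "\<eta> \<in> mp_class k g0" using \<eta> by (simp add: mem_mp_class_iff)
      qed
      show "I l (\<gamma> x) \<le> c + (C' + 1) * h" if "x \<in> unit_disc k" for x
      proof -
        have "0 \<le> h * B (\<gamma> x)" using B_nonneg h(1) by simp
        then show ?thesis using \<gamma>_le[OF that] I_split[of "\<gamma> x"] by linarith
      qed
      show "norm (\<gamma> x) \<le> K" if x: "x \<in> unit_disc k" "c - h \<le> I l (\<gamma> x)" for x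
      proof (rule K)
        \<comment> \<open>\<open>h * B\<close> is the gap between \<open>I (l - h)\<close>, below
          \<open>c + (C' + 1) * h\<close>, and \<open>I l\<close>, at least
          \<open>c - h\<close>.\<close>
        have "h * B (\<gamma> x) \<le> h * (C' + 2)"
          using \<gamma>_le[OF x(1)] x(2) I_split[of "\<gamma> x"] by (simp add: algebra_simps)
        then show B: "B (\<gamma> x) \<le> C' + 2" using h(1) by (simp only: mult_le_cancel_left_pos)
        have "A (\<gamma> x) = I (l - h) (\<gamma> x) + (l - h) * B (\<gamma> x)" by (simp add: I_def)
        moreover have "(l - h) * B (\<gamma> x) \<le> l * (C' + 2)"
          using B h B_nonneg \<open>l > 0\<close> by (intro mult_mono) auto
        moreover have "I (l - h) (\<gamma> x) \<le> c + (C' + 1)"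
        proof (rule order_trans[OF less_imp_le[OF \<gamma>_le[OF x(1)]] add_left_mono])
          show "(C' + 1) * h \<le> C' + 1" using h C' by (intro mult_left_le) auto
        qed
        ultimately show "A (\<gamma> x) \<le> c + (C' + 1) + l * (C' + 2)"
          by simp
      qed
      show "I l (- u) = I l u" for u by (rule I_even)
      show "(\<lambda>i. - x i) \<in> unit_disc k" if "x \<in> unit_disc k" for x
        using that by (rule unit_disc_uminus)
    qed (rule h(1) \<open>b > 0\<close> hb(1))+
    then obtain u where "norm u \<le> K + 1" "c - h \<le> I l u" "I l u \<le> c + (C' + 1) * h"
      "norm (dual_deriv (I l) u) \<le> 2 * b" by blast
    then show ?thesis using hb by (intro exI[of _ u]) auto
  qed
  have "\<exists>u. norm u \<le> K + 1 \<and> \<bar>I l u - c\<bar> \<le> 1 / Suc n \<and> norm (dual_deriv (I l) u) \<le> 2 * (1 / Suc n)" for n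
    by (rule approx) simp
  then obtain u where u: "\<And>n. norm (u n) \<le> K + 1" "\<And>n. \<bar>I l (u n) - c\<bar> \<le> 1 / Suc n"
    "\<And>n. norm (dual_deriv (I l) (u n)) \<le> 2 * (1 / Suc n)" by metis
  have lim: "(\<lambda>n. 1 / real (Suc n)) \<longlonglongrightarrow> 0"
    using LIMSEQ_inverse_real_of_nat by (simp add: inverse_eq_divide)
  have "bounded (range u)" using u(1) by (auto simp: bounded_iff)
  moreover have "(\<lambda>n. I l (u n)) \<longlonglongrightarrow> c"
    by (rule LIM_zero_cancel, rule Lim_null_comparison[OF _ lim]) (simp add: u(2) del: of_nat_Suc)
  moreover have "(\<lambda>n. dual_deriv (I l) (u n)) \<longlonglongrightarrow> 0"
    by (rule Lim_null_comparison[OF _ tendsto_mult_right_zero[OF lim, of 2]]) (simp only: u(3) eventually_True)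
  ultimately show ?thesis unfolding bounded_PS_sequence_def c_def by blast
qed

theorem theorem2p2:
  fixes A B :: "'a::banach \<Rightarrow> real"
    and I :: "real \<Rightarrow> 'a \<Rightarrow> real"
    and J :: "real set"
    and g0 :: "nat \<Rightarrow> (nat \<Rightarrow> real) \<Rightarrow> 'a"
  assumes "is_interval J" and "compact J" and "J \<noteq> {}" and "J \<subseteq> {0<..}"
    and "\<And>l u. l \<in> J \<Longrightarrow> I l u = A u - l * B u"
    and "C1_functional A" and "C1_functional B"
    and "\<And>u. A (- u) = A u" and "\<And>u. B (- u) = B u"
    and "A 0 = 0" and "B 0 = 0"
    and "\<And>u. B u \<ge> 0"
    and "filterlim A at_top at_infinity \<or> filterlim B at_top at_infinity"
    and "uniform_symmetric_mp_geometry J I g0"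
  shows "(AE l in lebesgue. l \<in> J \<longrightarrow>
            (\<forall>k\<ge>1. \<exists>u. bounded_PS_sequence (I l) (mp_level k (g0 k) (I l)) u)) \<and>
         (\<forall>k\<ge>1. \<forall>l\<in>J.
            continuous (at l within (J \<inter> {..<l})) (\<lambda>m. mp_level k (g0 k) (I m)))"
proof (intro conjI allI impI ballI)
  \<comment> \<open>The hypotheses describe \<open>I\<close> only on \<open>J\<close>;
    \<open>c k\<close> extends the level to all real parameters.\<close>
  define c where "c k m = mp_level k (g0 k) (\<lambda>u. A u - m * B u)" for k m
  have level_eq: "mp_level k (g0 k) (I l) = c k l" if "l \<in> J" for k l
  proof -
    have "I l = (\<lambda>u. A u - l * B u)" by (rule ext) (rule assms(5)[OF that])
    then show ?thesis by (simp add: c_def)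
  qed
  have cont: "continuous_on UNIV A" "continuous_on UNIV B"
    using C1_functional_continuous_on assms(6,7) by blast+
  then have I_cont: "continuous_on UNIV (\<lambda>u. A u - l * B u)" for l
    by (intro continuous_intros)
  have ne: "mp_class k (g0 k) \<noteq> {}" if "k \<ge> 1" for k
    using assms(14) that by (auto simp: uniform_symmetric_mp_geometry_def)
  have level_pos: "c k l > 0" if "k \<ge> 1" "l \<in> J" for k l
    using assms(14) that level_eq by (auto simp: uniform_symmetric_mp_geometry_def)
  \<comment> \<open>Real suprema bound their members only over sets bounded above. For the inner
    supremum this follows from an admissible map, continuous on the compact disc; for the outer one
    it is part of the geometry.\<close>
  have boundary: "A (g0 k x) - l * B (g0 k x) < 0" if kl: "k \<ge> 1" "l \<in> J" "x \<in> unit_sphere k" for k l x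
  proof -
    obtain \<gamma> where \<gamma>: "\<gamma> \<in> mp_class k (g0 k)" using ne[OF kl(1)] by blast
    have "bdd_above ((\<lambda>x. A (\<gamma> x) - l * B (\<gamma> x)) ` unit_sphere k)"
      using bdd_above_along_mp_class[OF I_cont \<gamma>] unit_sphere_subset_unit_disc
      by (rule bdd_above_mono[OF _ image_mono])
    also have "(\<lambda>x. A (\<gamma> x) - l * B (\<gamma> x)) ` unit_sphere k = (\<lambda>x. I l (g0 k x)) ` unit_sphere k"
      using \<gamma> assms(5)[OF kl(2)] by (intro image_cong) (auto simp: mem_mp_class_iff)
    finally have "I l (g0 k x) \<le> (SUP x\<in>unit_sphere k. I l (g0 k x))"
      by (intro cSUP_upper kl(3))
    also have "\<dots> \<le> (SUP l\<in>J. SUP x\<in>unit_sphere k. I l (g0 k x))"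
      using assms(14) kl by (intro cSUP_upper) (auto simp: uniform_symmetric_mp_geometry_def)
    also have "\<dots> < 0"
      using assms(14) kl by (auto simp: uniform_symmetric_mp_geometry_def)
    finally show ?thesis using assms(5)[OF kl(2)] by simp
  qed
  show "continuous (at l within (J \<inter> {..<l})) (\<lambda>m. mp_level k (g0 k) (I m))"
    if "1 \<le> k" "l \<in> J" for k l
  proof -
    have "(c k \<longlongrightarrow> c k l) (at_left l)"
      unfolding c_def by (rule mp_level_left_continuous[OF cont assms(10-12) ne[OF that(1)]])
    then have "(c k \<longlongrightarrow> c k l) (at l within (J \<inter> {..<l}))"
      by (rule tendsto_within_subset) simp
    moreover have "\<forall>\<^sub>F m in at l within (J \<inter> {..<l}). c k m = mp_level k (g0 k) (I m)"
      by (auto simp: eventually_at_filter level_eq)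
    ultimately show ?thesis
      using level_eq[OF that(2)] by (simp add: continuous_within tendsto_cong)
  qed
  obtain a b where J: "J = {a..b}"
    using assms(1,2) is_interval_compact[of J] by auto
  have "a \<le> b" using J assms(3) by auto
  \<comment> \<open>The level is nonincreasing, hence the sign; clamping to \<open>{a..b}\<close>
    makes \<open>F k\<close> depend only on levels with parameter in \<open>J\<close>.\<close>
  define F where "F k m = - c k (max a (min b m))" for k m
  have F_eq: "F k m = - c k m" if "m \<in> J" for k m
    using that by (simp add: F_def J)
  have "AE l in lborel. 1 \<le> k \<longrightarrow>
    (\<exists>C. \<exists>\<^sub>F n in sequentially. (F k l - F k (l - 1 / Suc n)) * Suc n \<le> C)" for k
  proof (cases "1 \<le> k")
    case True
    have "c k m \<le> c k m'" if "m' \<le> m" for m m'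
      unfolding c_def using that assms(10-12)
      by (intro mp_level_mono I_cont ne True diff_left_mono mult_right_mono) auto
    then have "mono (F k)"
      unfolding F_def by (intro monoI) (simp add: max.coboundedI2 min.coboundedI2 max.mono min.mono)
    then show ?thesis
      using AE_frequently_bounded_left_quotient True by simp
  qed simp
  \<comment> \<open>There are countably many dimensions, so one null set serves all
    \<open>k\<close>.\<close>
  then have "AE l in lborel. \<forall>k. 1 \<le> k \<longrightarrow>
    (\<exists>C. \<exists>\<^sub>F n in sequentially. (F k l - F k (l - 1 / Suc n)) * Suc n \<le> C)"
    by (subst AE_all_countable) (rule allI)
  \<comment> \<open>Away from the left endpoint, \<open>l - 1 / Suc n\<close> eventually lies in
    \<open>J\<close>, where quotients of \<open>F k\<close> are quotients of the level.\<close>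
  moreover have "AE l in lborel. l \<noteq> a" by (rule AE_lborel_singleton)
  ultimately have "AE l in lborel. l \<in> J \<longrightarrow>
    (\<forall>k\<ge>1. \<exists>u. bounded_PS_sequence (I l) (mp_level k (g0 k) (I l)) u)"
  proof eventually_elim
    case (elim l)
    show ?case
    proof (intro impI allI)
      fix k :: nat assume l: "l \<in> J" and k: "1 \<le> k"
      obtain C where C: "\<exists>\<^sub>F n in sequentially. (F k l - F k (l - 1 / Suc n)) * Suc n \<le> C"
        using elim k by blast
      have "(\<lambda>n. 1 / real (Suc n)) \<longlonglongrightarrow> 0"
        using LIMSEQ_inverse_real_of_nat by (simp add: inverse_eq_divide)
      moreover have "0 < l - a" using l elim J by auto
      ultimately have "\<forall>\<^sub>F n in sequentially. 1 / real (Suc n) < l - a"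
        by (rule order_tendstoD)
      then have "\<forall>\<^sub>F n in sequentially. (F k l - F k (l - 1 / Suc n)) * Suc n \<le> C \<longrightarrow>
        (c k (l - 1 / Suc n) - c k l) * Suc n \<le> C"
      proof eventually_elim
        case (elim n)
        have "0 < 1 / real (Suc n)" by simp
        then have "l - 1 / Suc n \<in> J" using elim l unfolding J atLeastAtMost_iff by linarith
        then show ?case using F_eq l by (simp del: of_nat_Suc)
      qed
      with C have "\<exists>\<^sub>F n in sequentially. (c k (l - 1 / Suc n) - c k l) * Suc n \<le> C"
        by (rule frequently_mp[rotated])
      then have "\<exists>u. bounded_PS_sequence (\<lambda>u. A u - l * B u) (c k l) u"
        unfolding c_def
        using bounded_PS_sequence_of_left_quotient[OF assms(6-13) _ ne[OF k] boundary[OF k l], of C]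
          l assms(4) level_pos[OF k l] by (auto simp: c_def)
      moreover have "I l = (\<lambda>u. A u - l * B u)" by (rule ext) (rule assms(5)[OF l])
      ultimately show "\<exists>u. bounded_PS_sequence (I l) (mp_level k (g0 k) (I l)) u"
        by (simp add: c_def)
    qed
  qed
  then show "AE l in lebesgue. l \<in> J \<longrightarrow>
    (\<forall>k\<ge>1. \<exists>u. bounded_PS_sequence (I l) (mp_level k (g0 k) (I l)) u)"
    by (rule AE_completion)
qed

end
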